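(* Let $\gamma\in\mathbb{C}$ with $0<|\gamma|<1$. For every integer $n\ge 1$ and every $z\in\mathbb{R}+i(-\Delta_\gamma,\Delta_\gamma)$, the equality $D_{\gamma,n}(\psi(z))=0$ holds if and only if there exists $j\in\mathbb{Z}$ such that $$z=\frac{j\pi}{n+1}+\frac{\vartheta_\gamma(z)}{n+1}.$$
   Context: For $\gamma\in\mathbb{C}$ and $n\ge 1$, $A_{\gamma,n}$ is the $n\times n$ matrix $T_n(a)+\gamma E_{n,1,1}$, where $T_n(a)$ is the tridiagonal Toeplitz matrix with entries $(T_n(a))_{j+1,j}=1$, $(T_n(a))_{j,j+1}=-1$ and all other entries $0$ (generating symbol $a(t)=t-t^{-1}$), and $E_{n,1,1}$ has entry $(1,1)$ equal to $1$ and all other entries $0$. $D_{\gamma,n}(\lambda)=\det(\lambda I_n-A_{\gamma,n})$ is its characteristic polynomial. $\psi(z)=i(e^{iz}+e^{-iz})=2i\cos(z)$. $\Delta_\gamma=\ln\frac{1}{|\gamma|}$, and $\mathbb{R}+i(-\Delta_\gamma,\Delta_\gamma)$ is the open strip of all $z\in\mathbb{C}$ with $|\operatorname{Im}(z)|<\Delta_\gamma$. For $z$ in this strip, $$\vartheta_\gamma(z)=-\frac{i}{2}\ln\left(\frac{1+i\gamma e^{iz}}{1+i\gamma e^{-iz}}\right),$$ where $\ln$ is the principal branch of the logarithm on $\mathbb{C}\setminus(-\infty,0]$ (the argument of the logarithm lies in this set for all such $z$).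
   Formalization: The right-hand side additionally requires that z is not an integer multiple of π: at z=kπ the equation holds with j=k(n+1), since ϑ_γ(kπ)=0, but D_{γ,n}(ψ(kπ))≠0, so the equivalence as stated fails there. *)

theory Defs
  imports "HOL-Analysis.Complex_Transcendental" "Jordan_Normal_Form.Determinant"
begin

(* Matrix indices start at 0 here, so the paper's entry (1,1) is the entry (0,0). *)

definition toeplitz_mat :: "nat \<Rightarrow> complex mat" where
  "toeplitz_mat n =
     mat n n (\<lambda>(j, k). if j = Suc k then 1 else if k = Suc j then - 1 else 0)"

definition E11_mat :: "nat \<Rightarrow> complex mat" where
  "E11_mat n = mat n n (\<lambda>(j, k). if j = 0 \<and> k = 0 then 1 else 0)"

definition A_mat :: "complex \<Rightarrow> nat \<Rightarrow> complex mat" where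
  "A_mat \<gamma> n = toeplitz_mat n + \<gamma> \<cdot>\<^sub>m E11_mat n"

definition D_char :: "complex \<Rightarrow> nat \<Rightarrow> complex \<Rightarrow> complex" where
  "D_char \<gamma> n x = det (x \<cdot>\<^sub>m 1\<^sub>m n - A_mat \<gamma> n)"

definition psi :: "complex \<Rightarrow> complex" where
  "psi z = \<i> * (exp (\<i> * z) + exp (- (\<i> * z)))"

definition Delta :: "complex \<Rightarrow> real" where
  "Delta \<gamma> = ln (1 / cmod \<gamma>)"

definition strip :: "complex \<Rightarrow> complex set" where
  "strip \<gamma> = {z. \<bar>Im z\<bar> < Delta \<gamma>}"

definition vartheta :: "complex \<Rightarrow> complex \<Rightarrow> complex" where
  "vartheta \<gamma> z =
     - (\<i> / 2) * ln ((1 + \<i> * \<gamma> * exp (\<i> * z)) / (1 + \<i> * \<gamma> * exp (- (\<i> * z))))"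

(* The points z = k * pi (k an integer) solve z = (j * pi + vartheta z) / (n + 1)
   with j = k * (n + 1), but they are not zeros of the characteristic polynomial
   composed with psi: the determinant carries a factor sin ((n + 1) * z) / sin z.
   An equivalence valid on the whole strip therefore has to exclude them.  The
   smallest instance of the failure: *)

lemma trivial_solution_not_eigenvalue:
  fixes \<gamma> z :: complex and n :: nat
  defines "\<gamma> \<equiv> 1 / 2" and "z \<equiv> 0" and "n \<equiv> 1"
  shows "0 < cmod \<gamma>" "cmod \<gamma> < 1" "z \<in> strip \<gamma>"
    and "\<exists>j::int. z = of_int j * of_real pi / (of_nat n + 1) + vartheta \<gamma> z / (of_nat n + 1)"
    and "D_char \<gamma> n (psi z) \<noteq> 0"
proof -
  show "0 < cmod \<gamma>" "cmod \<gamma> < 1" "z \<in> strip \<gamma>"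
    by (simp_all add: \<gamma>_def z_def strip_def Delta_def norm_divide)
  have "1 + \<i> * \<gamma> \<noteq> 0"
    by (simp add: \<gamma>_def complex_eq_iff)
  then have "vartheta \<gamma> z = 0"
    by (simp add: vartheta_def z_def)
  then show "\<exists>j::int. z = of_int j * of_real pi / (of_nat n + 1) + vartheta \<gamma> z / (of_nat n + 1)"
    by (intro exI[of _ 0]) (simp add: z_def)
  have "D_char \<gamma> n (psi z) = (psi z \<cdot>\<^sub>m 1\<^sub>m n - A_mat \<gamma> n) $$ (0, 0)"
    unfolding D_char_def
    by (rule det_single, rule carrier_matI)
      (simp_all add: n_def A_mat_def toeplitz_mat_def E11_mat_def)
  also have "\<dots> = 2 * \<i> - 1 / 2"
    by (simp add: A_mat_def toeplitz_mat_def E11_mat_def \<gamma>_def z_def n_def psi_def)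
  finally have "D_char \<gamma> n (psi z) = 2 * \<i> - 1 / 2" .
  then show "D_char \<gamma> n (psi z) \<noteq> 0"
    by (simp add: complex_eq_iff)
qed

end

theory Submission
  imports Defs
begin

text \<open>
  Put \<open>w = exp (\<i> * z)\<close>, so that \<open>psi z = \<i> * (w + 1 / w)\<close>. Expanding the determinant
  along its last row gives a three-term recurrence in \<open>n\<close> (\<open>det_tridiag_mat_Suc_Suc\<close>,
  \<open>D_char_Suc_Suc\<close>), whose characteristic roots at \<open>psi z\<close> are \<open>\<i> * w\<close> and \<open>\<i> / w\<close>.
  The perturbation \<open>\<gamma>\<close> sits in the opposite corner and therefore enters only through the
  initial values. Solving the recurrence yields (\<open>D_char_closed_form\<close>)
  \<open>(w - 1 / w) * D_char \<gamma> n (psi z) =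
     \<i> ^ n * (w ^ (n + 1) * (1 + \<i> * \<gamma> / w) - (1 / w) ^ (n + 1) * (1 + \<i> * \<gamma> * w))\<close>.

  The strip is exactly the region where \<open>\<gamma> * w\<close> and \<open>\<gamma> / w\<close> both have modulus below 1,
  so both factors in brackets are nonzero there. If \<open>w\<^sup>2 \<noteq> 1\<close>, the determinant thus
  vanishes precisely when \<open>w ^ (2 * (n + 1))\<close> equals the quotient
  \<open>(1 + \<i> * \<gamma> * w) / (1 + \<i> * \<gamma> / w)\<close>, and taking logarithms turns this into the asserted
  equation for \<open>z\<close>, the integer \<open>j\<close> accounting for the period of the exponential.
  If \<open>w\<^sup>2 = 1\<close>, that is, if \<open>z\<close> is an integer multiple of \<open>\<pi>\<close>, the characteristic roots
  collide; the determinant is then a unit times \<open>n + 1\<close> plus a term of modulus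
  \<open>n * cmod \<gamma>\<close>, hence nonzero (\<open>D_char_double_root_nonzero\<close>).
\<close>

section \<open>The determinant of a tridiagonal matrix\<close>

definition tridiag_mat ::
  "(nat \<Rightarrow> 'a) \<Rightarrow> (nat \<Rightarrow> 'a) \<Rightarrow> (nat \<Rightarrow> 'a) \<Rightarrow> nat \<Rightarrow> 'a::comm_ring_1 mat" where
  "tridiag_mat a b c n =
     mat n n (\<lambda>(i, j). if i = j then a i else if j = Suc i then b i
                       else if i = Suc j then c j else 0)"

lemma tridiag_mat_carrier [simp]: "tridiag_mat a b c n \<in> carrier_mat n n"
  by (simp add: tridiag_mat_def)

lemma tridiag_mat_index:
  "i < n \<Longrightarrow> j < n \<Longrightarrow> tridiag_mat a b c n $$ (i, j) =
     (if i = j then a i else if j = Suc i then b i else if i = Suc j then c j else 0)"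
  by (simp add: tridiag_mat_def)

lemma mat_delete_tridiag_last:
  "mat_delete (tridiag_mat a b c (Suc n)) n n = tridiag_mat a b c n"
  by (rule eq_matI) (auto simp: mat_delete_def tridiag_mat_def)

text \<open>
  The last row has only two nonzero entries. The minor belonging to the diagonal one is the
  leading block; the minor belonging to \<open>c n\<close> has \<open>b n\<close> as the only nonzero entry of its
  last column, so it reduces to the next smaller leading block.
\<close>

lemma det_tridiag_mat_Suc_Suc:
  "det (tridiag_mat a b c (Suc (Suc n))) =
     a (Suc n) * det (tridiag_mat a b c (Suc n)) - b n * c n * det (tridiag_mat a b c n)"
proof -
  let ?T = "tridiag_mat a b c"
  define M where "M = mat_delete (?T (Suc (Suc n))) (Suc n) n"
  have M: "M \<in> carrier_mat (Suc n) (Suc n)"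
    unfolding M_def by (simp add: mat_delete_def tridiag_mat_def)
  have M_last: "M $$ (i, n) = (if i = n then b n else 0)" if "i < Suc n" for i
    using that by (auto simp: M_def mat_delete_def tridiag_mat_def)
  have M_del: "mat_delete M n n = ?T n"
    by (rule eq_matI) (auto simp: M_def mat_delete_def tridiag_mat_def)
  have "det M = (\<Sum>i<Suc n. M $$ (i, n) * cofactor M i n)"
    by (rule laplace_expansion_column[OF M]) simp
  also have "\<dots> = b n * det (?T n)"
    by (simp add: M_last cofactor_def M_del)
  finally have det_M: "det M = b n * det (?T n)" .
  have "det (?T (Suc (Suc n))) =
      (\<Sum>j<Suc (Suc n). ?T (Suc (Suc n)) $$ (Suc n, j) * cofactor (?T (Suc (Suc n))) (Suc n) j)"
    by (rule laplace_expansion_row[OF tridiag_mat_carrier]) simp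
  also have "\<dots> = c n * cofactor (?T (Suc (Suc n))) (Suc n) n
      + a (Suc n) * cofactor (?T (Suc (Suc n))) (Suc n) (Suc n)"
    by (simp add: tridiag_mat_index)
  also have "\<dots> = a (Suc n) * det (?T (Suc n)) - b n * c n * det (?T n)"
    by (simp add: cofactor_def det_M flip: M_def) (simp add: mat_delete_tridiag_last)
  finally show ?thesis .
qed

section \<open>The characteristic polynomial\<close>

lemma D_char_eq_det_tridiag:
  "D_char \<gamma> n x =
     det (tridiag_mat (\<lambda>i. if i = 0 then x - \<gamma> else x) (\<lambda>_. 1) (\<lambda>_. - 1) n)"
  unfolding D_char_def
  by (rule arg_cong[of _ _ det], rule eq_matI)
     (auto simp: A_mat_def toeplitz_mat_def E11_mat_def tridiag_mat_def)

lemma D_char_0: "D_char \<gamma> 0 x = 1"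
  unfolding D_char_eq_det_tridiag by (rule det_dim_zero) simp

lemma D_char_1: "D_char \<gamma> (Suc 0) x = x - \<gamma>"
  unfolding D_char_eq_det_tridiag
  by (subst det_single) (auto simp: tridiag_mat_def)

lemma D_char_Suc_Suc:
  "D_char \<gamma> (Suc (Suc n)) x = x * D_char \<gamma> (Suc n) x + D_char \<gamma> n x"
  unfolding D_char_eq_det_tridiag det_tridiag_mat_Suc_Suc by simp

text \<open>
  The two characteristic roots \<open>\<i> * w\<close> and \<open>\<i> * v\<close> of the recurrence have product \<open>- 1\<close>
  because \<open>v\<close> is the inverse of \<open>w\<close>. Multiplying by \<open>w - v\<close> keeps the formula free of division,
  at the price of no information when the roots collide.
\<close>

lemma D_char_closed_form:
  assumes "w * v = 1"
  shows "(w - v) * D_char \<gamma> n (\<i> * (w + v)) =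
    \<i> ^ n * (w ^ Suc n * (1 + \<i> * \<gamma> * v) - v ^ Suc n * (1 + \<i> * \<gamma> * w))"
proof -
  \<comment> \<open>The right-hand side in the form in which both summands solve the recurrence.\<close>
  have "(w - v) * D_char \<gamma> n (\<i> * (w + v)) =
    \<i> ^ n * (w ^ Suc n - v ^ Suc n + \<i> * \<gamma> * (w ^ n - v ^ n))"
  proof (induction n rule: induct_nat_012)
    case 0
    show ?case by (simp add: D_char_0)
  next
    case 1
    show ?case by (simp add: D_char_1 algebra_simps)
  next
    case (ge2 n)
    have step: "(w + v) * (w ^ Suc m - v ^ Suc m) - (w ^ m - v ^ m) =
        w ^ Suc (Suc m) - v ^ Suc (Suc m)" for m
    proof -
      have "(w + v) * (w ^ Suc m - v ^ Suc m) =
          w ^ Suc (Suc m) - v ^ Suc (Suc m) + (w * v) * (w ^ m - v ^ m)"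
        by (simp add: algebra_simps)
      then show ?thesis by (simp add: assms)
    qed
    have "(w - v) * D_char \<gamma> (Suc (Suc n)) (\<i> * (w + v)) =
        \<i> * (w + v) * ((w - v) * D_char \<gamma> (Suc n) (\<i> * (w + v)))
        + (w - v) * D_char \<gamma> n (\<i> * (w + v))"
      by (simp add: D_char_Suc_Suc algebra_simps)
    also have "\<dots> = \<i> ^ Suc (Suc n) *
        (((w + v) * (w ^ Suc (Suc n) - v ^ Suc (Suc n)) - (w ^ Suc n - v ^ Suc n))
         + \<i> * \<gamma> * ((w + v) * (w ^ Suc n - v ^ Suc n) - (w ^ n - v ^ n)))"
      unfolding ge2 by (simp add: algebra_simps)
    finally show ?case by (simp only: step)
  qed
  also have "w ^ n = w ^ Suc n * v" using assms by (simp add: mult_ac)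
  also have "v ^ n = v ^ Suc n * w" using assms by (simp add: mult_ac)
  finally show ?thesis
    by (simp add: right_diff_distrib distrib_left mult_ac)
qed

text \<open>
  Here \<open>s\<close> is the double characteristic root: \<open>s = \<i> * w\<close> with \<open>w = 1\<close> or \<open>w = - 1\<close>. The
  solution of the recurrence is then an affine function of \<open>n\<close> times \<open>s ^ n\<close>.
\<close>

lemma D_char_double_root:
  assumes "s\<^sup>2 = - 1"
  shows "D_char \<gamma> n (2 * s) = s ^ n * (of_nat n + 1 + \<gamma> * s * of_nat n)"
proof (induction n rule: induct_nat_012)
  case 0
  show ?case by (simp add: D_char_0)
next
  case 1
  have "s * (2 + \<gamma> * s) = 2 * s + \<gamma> * s\<^sup>2"
    by (simp add: algebra_simps power2_eq_square)
  then show ?case by (simp add: D_char_1 assms)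
next
  case (ge2 n)
  have "D_char \<gamma> (Suc (Suc n)) (2 * s) =
      s ^ n * (2 * s\<^sup>2 * (of_nat n + 2 + \<gamma> * s * (of_nat n + 1))
        + (of_nat n + 1 + \<gamma> * s * of_nat n))"
    unfolding D_char_Suc_Suc ge2 by (simp add: algebra_simps power2_eq_square)
  also have "\<dots> = s ^ n * s\<^sup>2 * (of_nat n + 3 + \<gamma> * s * (of_nat n + 2))"
    by (simp add: assms algebra_simps)
  finally show ?case by (simp add: algebra_simps power2_eq_square)
qed

lemma D_char_double_root_nonzero:
  assumes "s\<^sup>2 = - 1" and "cmod \<gamma> < 1"
  shows "D_char \<gamma> n (2 * s) \<noteq> 0"
proof
  assume "D_char \<gamma> n (2 * s) = 0"
  moreover have "s \<noteq> 0" using assms(1) by auto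
  ultimately have "of_nat (Suc n) = - (\<gamma> * s * of_nat n)"
    using D_char_double_root[OF assms(1), of \<gamma> n] by (simp add: eq_neg_iff_add_eq_0 add_ac)
  then have "cmod (of_nat (Suc n)) = cmod (- (\<gamma> * s * of_nat n))"
    by (rule arg_cong)
  moreover have "cmod s = 1"
    using arg_cong[OF assms(1), of cmod] norm_ge_zero[of s]
    by (auto simp add: norm_power power2_eq_1_iff simp del: norm_ge_zero)
  ultimately have "real (Suc n) = cmod \<gamma> * real n"
    by (simp add: norm_mult del: of_nat_Suc)
  also have "\<dots> \<le> real n"
    using assms(2) by (simp add: mult_left_le_one_le)
  finally show False by simp
qed

section \<open>Exponentials on the strip\<close>

lemma norm_times_exp_less_1:
  assumes "\<gamma> \<noteq> 0" and "\<bar>Im z\<bar> < Delta \<gamma>"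
  shows "cmod (\<gamma> * exp (\<i> * z)) < 1"
proof -
  have "ln (cmod \<gamma>) - Im z < 0"
    using assms by (simp add: Delta_def ln_div)
  then have "exp (ln (cmod \<gamma>) - Im z) < 1" by simp
  then show ?thesis
    using assms(1) by (simp add: norm_mult exp_diff exp_minus field_simps)
qed

lemma one_plus_nonzero_if_norm_less_1:
  fixes x :: complex
  assumes "cmod x < 1"
  shows "1 + \<i> * x \<noteq> 0"
proof
  assume "1 + \<i> * x = 0"
  then have "\<i> * x = - 1" by (simp only: add_eq_0_iff)
  then have "cmod (\<i> * x) = 1" by simp
  then show False using assms by (simp add: norm_mult)
qed

lemma exp_eq_exp_minus_iff:
  "exp (\<i> * z) = exp (- (\<i> * z)) \<longleftrightarrow> (\<exists>k::int. z = of_int k * of_real pi)"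
proof -
  have "\<i> * z = - (\<i> * z) + of_int (2 * k) * of_real pi * \<i> \<longleftrightarrow> z = of_int k * of_real pi"
    for k :: int
  proof -
    have "\<i> * z = - (\<i> * z) + of_int (2 * k) * of_real pi * \<i> \<longleftrightarrow>
        2 * \<i> * z = 2 * \<i> * (of_int k * of_real pi)"
      by (simp add: algebra_simps)
    then show ?thesis by simp
  qed
  then show ?thesis by (simp add: exp_eq)
qed

text \<open>
  The choice of branch is absorbed by \<open>j\<close>: two logarithms of \<open>q\<close> differ by a multiple of
  \<open>2 * pi * \<i>\<close>, and division by \<open>2 * \<i>\<close> turns this into a multiple of \<open>pi\<close>.
\<close>

lemma exp_eq_iff_Ln:
  fixes q z :: complex and m :: nat
  assumes "q \<noteq> 0" and "m > 0"
  shows "exp (2 * of_nat m * (\<i> * z)) = q \<longleftrightarrow>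
    (\<exists>j::int. z = of_int j * of_real pi / of_nat m + (- (\<i> / 2) * ln q) / of_nat m)"
proof -
  have "exp (2 * of_nat m * (\<i> * z)) = q \<longleftrightarrow> exp (2 * of_nat m * (\<i> * z)) = exp (ln q)"
    using assms(1) by simp
  also have "\<dots> \<longleftrightarrow>
      (\<exists>j::int. 2 * of_nat m * (\<i> * z) = ln q + of_int (2 * j) * of_real pi * \<i>)"
    by (simp add: exp_eq)
  also have "\<dots> \<longleftrightarrow>
      (\<exists>j::int. z = of_int j * of_real pi / of_nat m + (- (\<i> / 2) * ln q) / of_nat m)"
  proof (rule arg_cong[of _ _ Ex], rule ext)
    fix j :: int
    let ?r = "of_int j * of_real pi / of_nat m + (- (\<i> / 2) * ln q) / of_nat m"
    have "2 * of_nat m * (\<i> * ?r) = ln q + of_int (2 * j) * of_real pi * \<i>"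
      using assms(2) by (simp add: field_simps)
    then have "2 * of_nat m * (\<i> * z) = ln q + of_int (2 * j) * of_real pi * \<i> \<longleftrightarrow>
        2 * of_nat m * (\<i> * z) = 2 * of_nat m * (\<i> * ?r)"
      by simp
    also have "\<dots> \<longleftrightarrow> z = ?r" using assms(2) by simp
    finally show "(2 * of_nat m * (\<i> * z) = ln q + of_int (2 * j) * of_real pi * \<i>) = (z = ?r)" .
  qed
  finally show ?thesis .
qed

section \<open>Zeros in the strip\<close>

theorem theorem1:
  fixes \<gamma> z :: complex and n :: nat
  assumes "0 < cmod \<gamma>" and "cmod \<gamma> < 1"
    and "n \<ge> 1"
    and "z \<in> strip \<gamma>"
  shows "D_char \<gamma> n (psi z) = 0 \<longleftrightarrow>
    (\<forall>k::int. z \<noteq> of_int k * of_real pi) \<and>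
    (\<exists>j::int. z = of_int j * of_real pi / (of_nat n + 1) + vartheta \<gamma> z / (of_nat n + 1))"
proof -
  define w where "w = exp (\<i> * z)"
  define v where "v = exp (- (\<i> * z))"
  have wv: "w * v = 1" by (simp add: w_def v_def flip: exp_add)
  have psi: "psi z = \<i> * (w + v)" by (simp add: psi_def w_def v_def)
  show ?thesis
  proof (cases "w = v")
    case True
    then have "(\<i> * w)\<^sup>2 = - 1"
      using wv by (simp add: power_mult_distrib flip: power2_eq_square)
    then have "D_char \<gamma> n (2 * (\<i> * w)) \<noteq> 0"
      using assms(2) by (rule D_char_double_root_nonzero)
    then have "D_char \<gamma> n (psi z) \<noteq> 0"
      using True by (simp add: psi mult_ac)
    with True show ?thesis
      by (auto simp: w_def v_def exp_eq_exp_minus_iff)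
  next
    case False
    define q where "q = (1 + \<i> * \<gamma> * w) / (1 + \<i> * \<gamma> * v)"
    have \<gamma>: "\<gamma> \<noteq> 0" and Im: "\<bar>Im z\<bar> < Delta \<gamma>"
      using assms by (auto simp: strip_def)
    have "1 + \<i> * (\<gamma> * w) \<noteq> 0" "1 + \<i> * (\<gamma> * v) \<noteq> 0"
      using norm_times_exp_less_1[OF \<gamma> Im] norm_times_exp_less_1[OF \<gamma>, of "- z"] Im
      by (auto intro!: one_plus_nonzero_if_norm_less_1 simp: w_def v_def)
    then have nz: "1 + \<i> * \<gamma> * w \<noteq> 0" "1 + \<i> * \<gamma> * v \<noteq> 0"
      by (simp_all add: mult.assoc)
    have "w ^ Suc n * v ^ Suc n = 1"
      using wv by (metis power_mult_distrib power_one)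
    then have v_pow: "v ^ Suc n = 1 / w ^ Suc n" and w_pow: "w ^ Suc n \<noteq> 0"
      by (auto simp: divide_simps mult.commute w_def)
    have "D_char \<gamma> n (psi z) = 0 \<longleftrightarrow> (w - v) * D_char \<gamma> n (psi z) = 0"
      using False by simp
    also have "\<dots> \<longleftrightarrow> w ^ Suc n * (1 + \<i> * \<gamma> * v) = v ^ Suc n * (1 + \<i> * \<gamma> * w)"
      unfolding psi D_char_closed_form[OF wv] by simp
    also have "\<dots> \<longleftrightarrow> w ^ Suc n * w ^ Suc n = q"
      unfolding q_def v_pow using nz w_pow by (simp add: divide_simps mult_ac del: power_Suc)
    also have "w ^ Suc n * w ^ Suc n = exp (2 * of_nat (Suc n) * (\<i> * z))"
      unfolding w_def exp_of_nat_mult[symmetric] exp_add[symmetric]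
      by (simp only: mult_2 distrib_right)
    also have "exp (2 * of_nat (Suc n) * (\<i> * z)) = q \<longleftrightarrow>
        (\<exists>j::int. z = of_int j * of_real pi / of_nat (Suc n)
                      + (- (\<i> / 2) * ln q) / of_nat (Suc n))"
      using nz by (intro exp_eq_iff_Ln) (simp_all add: q_def)
    also have "- (\<i> / 2) * ln q = vartheta \<gamma> z"
      by (simp add: vartheta_def q_def w_def v_def)
    finally show ?thesis
      using False by (auto simp: w_def v_def exp_eq_exp_minus_iff add.commute)
  qed
qed

end
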